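(* For $m,d\ge 0$ let $H_d(m)$ be the number of partitions of $2m$ of Durfee size $d$ for which the hook length of every cell on the main diagonal is even. For $d\geq 1$, $$\sum_{m\geq0}H_d(m)q^m=\frac{2q^{\binom{d+1}{2}}(-q;q)_{d-1}}{(q;q)_d^2},$$ and for $d=0$ the generating function $\sum_{m\ge0}H_0(m)q^m$ is $1$. Moreover, the right-hand side of the displayed formula is the generating function for overpartitions (by size) whose Frobenius representation has $d$ columns. Thus the equinumerosity between partitions of $2m$ all of whose principal hooks are even and overpartitions of $m$ is refined by the Durfee-size/Frobenius-column statistic: for all $m,d\ge 0$, $H_d(m)$ equals the number of overpartitions of $m$ whose Frobenius representation has $d$ columns.
   Context: Notation: $(a;q)_N=\prod_{j=0}^{N-1}(1-aq^j)$. The Durfee size of a partition is the side of the largest square contained in its Young diagram; the principal hooks are the hooks of the cells on the main diagonal. An overpartition is a partition in which the first occurrence of each distinct part may be overlined. The Frobenius representation of an overpartition with $d$ columns is a two-row array whose top row consists of $d$ distinct nonnegative integers (in decreasing order) and whose bottom row is an overpartition into $d$ nonnegative parts (parts equal to $0$ allowed, the first occurrence of each distinct value, including $0$, may be overlined); its weight is $d$ plus the sum of all entries. It is a standard fact (Corteel–Lovejoy, Lovejoy) that overpartitions of $m$ are in bijection with such arrays of weight $m$ (over all $d\ge0$); the number of overpartitions of $m$ whose Frobenius representation has $d$ columns is the number of such arrays with $d$ columns and weight $m$. *)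

theory Defs
  imports "HOL-Computational_Algebra.Formal_Power_Series"
begin

text \<open>Partitions are weakly decreasing lists of positive parts; rows, columns and cells of the
  Young diagram are indexed from 0.\<close>

definition is_partition :: "nat \<Rightarrow> nat list \<Rightarrow> bool" where
  "is_partition n p \<longleftrightarrow> sorted_wrt (\<ge>) p \<and> (\<forall>x\<in>set p. 0 < x) \<and> sum_list p = n"

definition young_diagram :: "nat list \<Rightarrow> (nat \<times> nat) set" where
  "young_diagram p = {(i, j). i < length p \<and> j < p ! i}"

definition durfee :: "nat list \<Rightarrow> nat" where
  "durfee p = Max {s. {..<s} \<times> {..<s} \<subseteq> young_diagram p}"

definition hook_length :: "nat list \<Rightarrow> nat \<times> nat \<Rightarrow> nat" where
  "hook_length p = (\<lambda>(i, j).
     card {(k, l) \<in> young_diagram p. (k = i \<and> j \<le> l) \<or> (i \<le> k \<and> l = j)})"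

definition H :: "nat \<Rightarrow> nat \<Rightarrow> nat" where
  "H d m = card {p. is_partition (2 * m) p \<and> durfee p = d \<and>
     (\<forall>i. (i, i) \<in> young_diagram p \<longrightarrow> even (hook_length p (i, i)))}"

text \<open>An entry \<open>(a, s)\<close> is the part \<open>a\<close>, overlined iff \<open>s\<close>. Since \<^const>\<open>sorted_wrt\<close> compares
  each entry with all earlier ones, the condition on \<open>t\<close> says that an overlined part is the first
  occurrence of its value. Parts equal to 0 are allowed.\<close>

definition is_overpartition :: "(nat \<times> bool) list \<Rightarrow> bool" where
  "is_overpartition p \<longleftrightarrow> sorted_wrt (\<lambda>(a, s) (b, t). b \<le> a \<and> (t \<longrightarrow> b < a)) p"

text \<open>Frobenius representations, as pairs (top row, bottom row).\<close>

definition is_frobenius_array :: "nat \<Rightarrow> nat list \<times> (nat \<times> bool) list \<Rightarrow> bool" where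
  "is_frobenius_array d = (\<lambda>(a, b).
     length a = d \<and> sorted_wrt (>) a \<and> length b = d \<and> is_overpartition b)"

definition frobenius_weight :: "nat list \<times> (nat \<times> bool) list \<Rightarrow> nat" where
  "frobenius_weight = (\<lambda>(a, b). length a + sum_list a + sum_list (map fst b))"

text \<open>The number of overpartitions of \<open>m\<close> whose Frobenius representation has \<open>d\<close> columns: as
  overpartitions of \<open>m\<close> correspond bijectively to arrays of weight \<open>m\<close>, this is the number of
  arrays with \<open>d\<close> columns and weight \<open>m\<close>.\<close>

definition overpartitions_with_columns :: "nat \<Rightarrow> nat \<Rightarrow> nat" where
  "overpartitions_with_columns d m =
     card {A. is_frobenius_array d A \<and> frobenius_weight A = m}"

definition qpoch :: "'a::comm_ring_1 \<Rightarrow> 'a \<Rightarrow> nat \<Rightarrow> 'a" where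
  "qpoch a q N = (\<Prod>j<N. 1 - a * q ^ j)"

end

theory Submission
  imports Defs
begin

text \<open>Write a partition in Frobenius coordinates, that is, as a strictly decreasing chain of pairs
  \<open>(a, b)\<close> of arm and leg lengths of the diagonal cells; all principal hooks are even iff
  \<open>a + b\<close> is odd in every pair. Consecutive pairs whose half hook lengths differ by \<open>j\<close> can be
  chosen in \<open>2 j - 1\<close> ways, and a last pair with half hook length \<open>n\<close> in \<open>2 n\<close> ways. In a Frobenius
  array, let each column carry the overlining of the next bottom entry (cyclically), so that
  whether two columns may be adjacent depends on the mark of the left one only. With the weight
  \<open>a + b + 1\<close> of a column in place of the half hook length, the same two counts hold. They determine
  the generating function: the \<open>j\<close>-th difference contributes a factor
  \<open>x (1 + x) / (1 - x)\<^sup>2\<close> with \<open>x = q\<^sup>j\<close>, and the last column \<open>2 x / (1 - x)\<^sup>2\<close>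
  with \<open>x = q\<^sup>d\<close>.\<close>

section \<open>Counting chains by weight\<close>

lemma fps_nth_compose_fps_X_power:
  fixes F :: "'a::comm_ring_1 fps"
  assumes "0 < r"
  shows "fps_nth (F oo fps_X ^ r) n = (if r dvd n then fps_nth F (n div r) else 0)"
proof -
  have "fps_nth (F oo fps_X ^ r) n = (\<Sum>i\<in>{0..n}. if n = r * i then fps_nth F i else 0)"
    by (simp add: fps_compose_nth fps_X_power_nth flip: power_mult cong: if_cong)
       (intro sum.cong, auto)
  also have "\<dots> = (\<Sum>i\<in>{0..n} \<inter> {i. n = r * i}. fps_nth F i)"
    by (simp add: sum.inter_restrict)
  also have "{0..n} \<inter> {i. n = r * i} = (if r dvd n then {n div r} else {})"
    using assms by auto
  finally show ?thesis by simp
qed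

lemma fps_double:
  "Abs_fps (\<lambda>n. of_nat (2 * n) :: 'a::comm_ring_1) * (1 - fps_X)\<^sup>2 = 2 * fps_X"
proof -
  \<comment> \<open>Each factor \<open>1 - fps_X\<close> takes differences of consecutive
    coefficients: 0, 2, 4, 6, ... becomes 0, 2, 2, 2, ... and then 0, 2, 0, 0, ...\<close>
  have "Abs_fps (\<lambda>n. of_nat (2 * n) :: 'a) * (1 - fps_X) = Abs_fps (\<lambda>n. if n = 0 then 0 else 2)"
    by (rule fps_ext) (simp add: ring_distribs of_nat_diff)
  also have "\<dots> * (1 - fps_X) = 2 * fps_X"
    by (rule fps_ext) (auto simp: ring_distribs fps_X_nth numeral_fps_const)
  finally show ?thesis by (simp add: power2_eq_square mult.assoc)
qed

text \<open>Truncated subtraction makes the coefficient at 0 vanish, so the sequence is 0, 1, 3, 5,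
  ...; differencing twice leaves 0, 1, 1, 0, ...\<close>

lemma fps_odd:
  "Abs_fps (\<lambda>n. of_nat (2 * n - 1) :: 'a::comm_ring_1) * (1 - fps_X)\<^sup>2 = fps_X * (1 + fps_X)"
proof -
  have "Abs_fps (\<lambda>n. of_nat (2 * n - 1) :: 'a) * (1 - fps_X) =
      Abs_fps (\<lambda>n. if n = 0 then 0 else if n = 1 then 1 else 2)"
    by (rule fps_ext) (auto simp: ring_distribs of_nat_diff)
  also have "\<dots> * (1 - fps_X) = fps_X * (1 + fps_X)"
    by (rule fps_ext) (auto simp: ring_distribs fps_X_nth)
  finally show ?thesis by (simp add: power2_eq_square mult.assoc)
qed

lemma qpoch_Suc_front: "qpoch a q (Suc n) = (1 - a) * qpoch (a * q) q n"
  unfolding qpoch_def by (simp add: prod.lessThan_Suc_shift mult.assoc del: prod.lessThan_Suc)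

text \<open>The data that determine the generating function: the number of possible predecessors of
  \<open>y\<close> depends on the gap \<open>j\<close> alone. At \<open>j = 0\<close> it is 0, which
  together with \<open>finite_level\<close> makes \<open>k\<close> drop strictly along a
  chain.\<close>

locale weighted_chains =
  fixes R :: "'a \<Rightarrow> 'a \<Rightarrow> bool" and Q :: "'a \<Rightarrow> bool" and k :: "'a \<Rightarrow> nat"
  assumes trans: "transp R"
    and mono: "\<lbrakk>R x y; Q x; Q y\<rbrakk> \<Longrightarrow> k y \<le> k x"
    and finite_level: "finite {x. Q x \<and> k x = n}"
    and card_level: "card {x. Q x \<and> k x = n} = 2 * n"
    and card_step: "Q y \<Longrightarrow> card {x. Q x \<and> R x y \<and> k x = k y + j} = 2 * j - 1"
begin

definition chains :: "nat \<Rightarrow> 'a list set" where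
  "chains d = {xs. length xs = d \<and> sorted_wrt R xs \<and> (\<forall>x\<in>set xs. Q x)}"

text \<open>The parameter \<open>i\<close> makes the removal of the first element a recursion: the gap to the next
  element is counted \<open>Suc i\<close> times, and the remaining chain has weight \<open>weight (Suc i)\<close>.
  At \<open>[]\<close> the weight is meaningful only for \<open>i = 0\<close>.\<close>

definition weight :: "nat \<Rightarrow> 'a list \<Rightarrow> nat" where
  "weight i xs = sum_list (map k xs) + i * k (hd xs)"

definition gf :: "nat \<Rightarrow> nat \<Rightarrow> rat fps" where
  "gf d i = Abs_fps (\<lambda>m. of_nat (card {xs \<in> chains d. weight i xs = m}))"

lemma finite_chains: "finite {xs \<in> chains d. weight i xs = m}"
proof (rule finite_subset)
  have "k x \<le> sum_list (map k xs)" if "x \<in> set xs" for x xs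
    using that by (simp add: member_le_sum_list)
  then show "{xs \<in> chains d. weight i xs = m}
      \<subseteq> {xs. set xs \<subseteq> (\<Union>n\<le>m. {x. Q x \<and> k x = n}) \<and> length xs = d}"
    by (fastforce simp: chains_def weight_def)
  show "finite {xs. set xs \<subseteq> (\<Union>n\<le>m. {x. Q x \<and> k x = n}) \<and> length xs = d}"
    by (intro finite_lists_length_eq finite_UN_I finite_level) simp
qed

text \<open>Splitting off the first element \<open>x\<close> leaves a chain \<open>t\<close>, and
  the number of possible \<open>x\<close> depends only on the gap \<open>k x - k (hd t)\<close>;
  hence a convolution, with \<open>u\<close> the weight of the tail. Since \<open>0 < d\<close>,
  \<open>hd t\<close> is a genuine element.\<close>

lemma card_chains_Suc:
  assumes "0 < d"
  shows "card {xs \<in> chains (Suc d). weight i xs = m} =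
    (\<Sum>u\<le>m. (if Suc i dvd m - u then 2 * ((m - u) div Suc i) - 1 else 0) *
      card {t \<in> chains d. weight (Suc i) t = u})"
proof -
  \<comment> \<open>\<open>B n y\<close> collects the elements that can precede \<open>y\<close>
    with a gap contributing \<open>n\<close> to the weight; the gap itself is then
    \<open>n div Suc i\<close>.\<close>
  define B where "B n y = {x. Q x \<and> R x y \<and> Suc i * (k x - k y) = n}" for n y
  have card_B: "card (B n y) = (if Suc i dvd n then 2 * (n div Suc i) - 1 else 0)"
    and fin_B: "finite (B n y)" if "Q y" for n y
  proof -
    have eq: "B n y = (if Suc i dvd n then {x. Q x \<and> R x y \<and> k x = k y + n div Suc i} else {})"
      using mono[OF _ _ that] unfolding B_def
      by (auto simp del: mult_Suc)
    show "card (B n y) = (if Suc i dvd n then 2 * (n div Suc i) - 1 else 0)"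
      unfolding eq using card_step[OF that] by simp
    show "finite (B n y)"
      unfolding eq by (auto intro: finite_subset[OF _ finite_level])
  qed
  let ?T = "\<lambda>u. {t \<in> chains d. weight (Suc i) t = u}"
  let ?S = "\<lambda>u. SIGMA t : ?T u. B (m - u) (hd t)"
  have Q_hd: "Q (hd t)" if "t \<in> chains d" for t
    using that assms by (auto simp: chains_def)
  \<comment> \<open>\<open>k x\<close> is counted \<open>Suc i\<close> times: this gives
    \<open>Suc i\<close> copies of the gap and \<open>Suc i\<close> copies of
    \<open>k (hd t)\<close>, one more than \<open>sum_list\<close> needs \<open>i\<close> for, and
    these pass into the weight of the tail.\<close>
  have weight_Cons: "weight i (x # t) = Suc i * (k x - k (hd t)) + weight (Suc i) t"
    if "t \<in> chains d" "Q x" "R x (hd t)" for x t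
  proof -
    have "k (hd t) \<le> k x"
      using mono[OF that(3,2) Q_hd[OF that(1)]] .
    then obtain e where "k x = k (hd t) + e"
      using le_Suc_ex by blast
    then show ?thesis
      unfolding weight_def by (simp add: algebra_simps)
  qed
  \<comment> \<open>By transitivity \<open>x\<close> need only be compared with the head of
    \<open>t\<close>.\<close>
  have Cons_iff: "x # t \<in> chains (Suc d) \<longleftrightarrow> t \<in> chains d \<and> Q x \<and> R x (hd t)" for x t
  proof (cases t)
    case Nil
    then show ?thesis using assms by (simp add: chains_def)
  next
    case (Cons y ys)
    then show ?thesis by (auto simp: chains_def sorted_wrt2[OF trans] simp del: sorted_wrt.simps(2))
  qed
  have split: "{xs \<in> chains (Suc d). weight i xs = m} = (\<lambda>(t, x). x # t) ` (\<Union>u\<le>m. ?S u)" (is "?L = ?R")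
  proof (intro equalityI subsetI)
    fix xs assume xs: "xs \<in> ?L"
    then obtain x t where [simp]: "xs = x # t" by (cases xs) (auto simp: chains_def)
    from xs have t: "t \<in> chains d" "Q x" "R x (hd t)" "weight i (x # t) = m"
      by (auto simp: Cons_iff)
    then have "(t, x) \<in> ?S (weight (Suc i) t)" "weight (Suc i) t \<le> m"
      using weight_Cons[OF t(1-3)] by (auto simp: B_def simp del: mult_Suc)
    then show "xs \<in> ?R" by force
  next
    fix xs assume "xs \<in> ?R"
    then show "xs \<in> ?L"
      by (auto simp: Cons_iff B_def weight_Cons simp del: mult_Suc)
  qed
  have "card {xs \<in> chains (Suc d). weight i xs = m} = card (\<Union>u\<le>m. ?S u)"
    unfolding split by (rule card_image) (auto simp: inj_on_def)
  \<comment> \<open>The sets are disjoint because \<open>t\<close> determines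
    \<open>u\<close>.\<close>
  also have "\<dots> = (\<Sum>u\<le>m. card (?S u))"
    by (rule card_UN_disjoint) (auto intro!: finite_SigmaI finite_chains fin_B Q_hd)
  also have "\<dots> = (\<Sum>u\<le>m. \<Sum>t\<in>?T u. card (B (m - u) (hd t)))"
    by (intro sum.cong refl card_SigmaI) (auto intro!: finite_chains fin_B Q_hd)
  also have "\<dots> = (\<Sum>u\<le>m. (if Suc i dvd m - u then 2 * ((m - u) div Suc i) - 1 else 0) * card (?T u))"
    by (intro sum.cong refl) (simp add: card_B Q_hd)
  finally show ?thesis .
qed

text \<open>The convolution is a product of series. A gap \<open>j\<close> contributes
  \<open>Suc i * j\<close>, so the series of odd numbers is evaluated at
  \<open>fps_X ^ Suc i\<close>. Its denominator stays on the left, which avoids division in the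
  later induction.\<close>

lemma gf_Suc:
  assumes "0 < d"
  shows "gf (Suc d) i * (1 - fps_X ^ Suc i)\<^sup>2 =
    fps_X ^ Suc i * (1 + fps_X ^ Suc i) * gf d (Suc i)"
proof -
  let ?F = "Abs_fps (\<lambda>n. of_nat (2 * n - 1) :: rat)"
  have "gf (Suc d) i = gf d (Suc i) * (?F oo fps_X ^ Suc i)"
  proof (rule fps_ext)
    fix m
    show "fps_nth (gf (Suc d) i) m = fps_nth (gf d (Suc i) * (?F oo fps_X ^ Suc i)) m"
      unfolding gf_def fps_mult_nth fps_nth_Abs_fps card_chains_Suc[OF assms]
      by (subst fps_nth_compose_fps_X_power)
         (auto intro!: sum.cong simp: atMost_atLeast0)
  qed
  moreover have "(?F oo fps_X ^ Suc i) * (1 - fps_X ^ Suc i)\<^sup>2 = fps_X ^ Suc i * (1 + fps_X ^ Suc i)"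
  proof -
    have "(?F * (1 - fps_X)\<^sup>2) oo fps_X ^ Suc i = (fps_X * (1 + fps_X)) oo fps_X ^ Suc i"
      unfolding fps_odd ..
    then show ?thesis
      by (simp add: fps_compose_mult_distrib fps_compose_add_distrib fps_compose_sub_distrib
          flip: fps_compose_power)
  qed
  ultimately show ?thesis by (simp only: mult.assoc mult.commute[of _ "gf d (Suc i)"] mult.left_commute[of _ "gf d (Suc i)"])
qed

lemma gf_1: "gf 1 i * (1 - fps_X ^ Suc i)\<^sup>2 = 2 * fps_X ^ Suc i"
proof -
  let ?F = "Abs_fps (\<lambda>n. of_nat (2 * n) :: rat)"
  \<comment> \<open>A single element counts once in the sum and \<open>i\<close> times as the
    head.\<close>
  have "{xs \<in> chains 1. weight i xs = m} = (\<lambda>x. [x]) ` {x. Q x \<and> Suc i * k x = m}" for m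
    by (auto simp: chains_def weight_def length_Suc_conv)
  moreover have "{x. Q x \<and> Suc i * k x = m} =
      (if Suc i dvd m then {x. Q x \<and> k x = m div Suc i} else {})" for m
    by (auto simp del: mult_Suc)
  moreover have "card ((\<lambda>x. [x]) ` A) = card A" for A :: "'a set"
    by (rule card_image) (simp add: inj_on_def)
  ultimately have card: "card {xs \<in> chains 1. weight i xs = m} =
      (if Suc i dvd m then 2 * (m div Suc i) else 0)" for m
    by (simp add: card_level del: mult_Suc)
  have "gf 1 i = ?F oo fps_X ^ Suc i"
    by (rule fps_ext, subst fps_nth_compose_fps_X_power) (simp_all add: gf_def card[simplified])
  moreover have "(?F * (1 - fps_X)\<^sup>2) oo fps_X ^ Suc i = (2 * fps_X) oo fps_X ^ Suc i"
    unfolding fps_double ..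
  ultimately show ?thesis
    by (simp add: fps_compose_mult_distrib fps_compose_add_distrib fps_compose_sub_distrib
        flip: fps_compose_power)
qed

text \<open>With q for \<open>fps_X\<close>, iterating \<open>gf_Suc\<close> yields the factors at
  q^(i+1), ..., q^(i+d), and \<open>gf_1\<close> the last one at q^(i+d+1), with 2 in place of
  \<open>1 + x\<close>. Each step raises \<open>i\<close>, so the induction keeps \<open>i\<close>
  general.\<close>

lemma gf_qpoch:
  "gf (Suc d) i * (qpoch (fps_X ^ Suc i) fps_X (Suc d))\<^sup>2 =
     2 * fps_X ^ (Suc d * Suc i + (Suc d choose 2)) * qpoch (- (fps_X ^ Suc i)) fps_X d"
proof (induction d arbitrary: i)
  case 0
  show ?case using gf_1[of i] by (simp add: qpoch_def)
next
  case (Suc d)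
  let ?x = "fps_X ^ Suc i :: rat fps"
  have shift: "?x * fps_X = fps_X ^ Suc (Suc i)" by simp
  have "gf (Suc (Suc d)) i * (qpoch ?x fps_X (Suc (Suc d)))\<^sup>2 =
      (gf (Suc (Suc d)) i * (1 - ?x)\<^sup>2) * (qpoch (fps_X ^ Suc (Suc i)) fps_X (Suc d))\<^sup>2"
    unfolding qpoch_Suc_front[of ?x fps_X "Suc d"] shift power_mult_distrib by (simp only: mult.assoc)
  also have "\<dots> = ?x * (1 + ?x) *
      (gf (Suc d) (Suc i) * (qpoch (fps_X ^ Suc (Suc i)) fps_X (Suc d))\<^sup>2)"
    by (subst gf_Suc) (simp_all only: mult.assoc zero_less_Suc)
  also have "\<dots> = 2 * (?x * fps_X ^ (Suc d * Suc (Suc i) + (Suc d choose 2))) *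
      ((1 + ?x) * qpoch (- (fps_X ^ Suc (Suc i))) fps_X d)"
    unfolding Suc.IH by (simp only: ac_simps)
  \<comment> \<open>Pascal's rule absorbs the \<open>Suc d\<close> left over from
    \<open>Suc d * Suc (Suc i)\<close>.\<close>
  also have "?x * fps_X ^ (Suc d * Suc (Suc i) + (Suc d choose 2)) =
      fps_X ^ (Suc (Suc d) * Suc i + (Suc (Suc d) choose 2))"
    unfolding power_add[symmetric] by (rule arg_cong) (simp add: numeral_2_eq_2)
  also have "(1 + ?x) * qpoch (- (fps_X ^ Suc (Suc i))) fps_X d = qpoch (- ?x) fps_X (Suc d)"
    unfolding qpoch_Suc_front[of "- ?x"] shift[symmetric] by simp
  finally show ?case .
qed

lemma gf_closed_form:
  assumes "1 \<le> d"
  shows "gf d 0 = 2 * fps_X ^ ((d + 1) choose 2) * qpoch (- fps_X) fps_X (d - 1) / (qpoch fps_X fps_X d)\<^sup>2"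
proof -
  obtain e where d: "d = Suc e" using assms by (cases d) auto
  \<comment> \<open>Constant coefficient 1 makes the denominator nonzero, so it can be
    cancelled.\<close>
  have "fps_nth (qpoch fps_X fps_X d) 0 = (1 :: rat)"
    by (simp add: qpoch_def fps_prod_nth')
  then have "(qpoch fps_X fps_X d)\<^sup>2 \<noteq> (0 :: rat fps)"
    by auto
  moreover have "gf d 0 * (qpoch fps_X fps_X d)\<^sup>2 =
      2 * fps_X ^ ((d + 1) choose 2) * qpoch (- fps_X) fps_X (d - 1)"
    using gf_qpoch[of e 0] by (simp add: d numeral_2_eq_2)
  ultimately show ?thesis
    by (metis nonzero_mult_div_cancel_right)
qed

lemma card_chains_0: "card {xs \<in> chains 0. weight 0 xs = m} = (if m = 0 then 1 else 0)"
proof -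
  have "{xs \<in> chains 0. weight 0 xs = m} = (if m = 0 then {[]} else {})"
    by (auto simp: chains_def weight_def)
  then show ?thesis by simp
qed

end

section \<open>Frobenius coordinates of partitions\<close>

text \<open>Each step wraps one principal hook, with arm \<open>a\<close> and leg \<open>b\<close>, around the diagram \<open>q\<close>.\<close>

fun of_frobenius :: "(nat \<times> nat) list \<Rightarrow> nat list" where
  "of_frobenius [] = []"
| "of_frobenius ((a, b) # xs) = (let q = of_frobenius xs in
     Suc a # map Suc q @ replicate (b - length q) 1)"

section \<open>Dominating chains correspond bijectively to partitions\<close>

definition dominates :: "nat \<times> nat \<Rightarrow> nat \<times> nat \<Rightarrow> bool" where
  "dominates x y \<longleftrightarrow> fst y < fst x \<and> snd y < snd x"

lemma transp_dominates: "transp dominates"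
  by (auto simp: transp_def dominates_def)

text \<open>The inner diagram fits into the hook around it, so \<open>b - length q\<close> in
  \<open>of_frobenius\<close> is not truncated. Wrapping gives exactly \<open>b + 1\<close> rows and
  largest part \<open>a + 1\<close>, and a dominating pair leaves room for both.\<close>

lemma of_frobenius_bounds:
  "sorted_wrt dominates ((a, b) # xs) \<Longrightarrow>
     length (of_frobenius xs) \<le> b \<and> (\<forall>y\<in>set (of_frobenius xs). y \<le> a)"
proof (induction xs arbitrary: a b)
  case (Cons x xs)
  obtain a' b' where x: "x = (a', b')" by (cases x)
  from Cons.prems have "sorted_wrt dominates ((a', b') # xs)" "a' < a" "b' < b"
    by (simp_all add: x dominates_def[of "(a, b)" "(a', b')"])
  moreover from Cons.IH[OF this(1)] have "length (of_frobenius xs) \<le> b'"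
    "\<And>y. y \<in> set (of_frobenius xs) \<Longrightarrow> y \<le> a'"
    by blast+
  ultimately show ?case
    by (fastforce simp: x Let_def)
qed simp

lemma of_frobenius_pos: "\<forall>y\<in>set (of_frobenius xs). 0 < y"
  by (induction xs rule: of_frobenius.induct) (auto simp: Let_def)

lemma of_frobenius_sorted:
  "sorted_wrt dominates xs \<Longrightarrow> sorted_wrt (\<ge>) (of_frobenius xs)"
proof (induction xs rule: of_frobenius.induct)
  case (2 a b xs)
  have "sorted_wrt (\<ge>) (replicate n (1::nat))" for n
    by (induction n) auto
  with 2 of_frobenius_bounds[of a b xs] show ?case
    by (auto simp: Let_def sorted_wrt_append sorted_wrt_map)
qed simp

text \<open>A wrap adds \<open>a + 1\<close> cells in the new row, \<open>length q\<close> by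
  lengthening the old rows and \<open>b - length q\<close> ones below.\<close>

lemma of_frobenius_sum:
  "sorted_wrt dominates xs \<Longrightarrow> sum_list (of_frobenius xs) = (\<Sum>(a, b)\<leftarrow>xs. a + b + 1)"
proof (induction xs rule: of_frobenius.induct)
  case (2 a b xs)
  have "sum_list (map Suc q) = sum_list q + length q" for q
    by (induction q) auto
  with 2 of_frobenius_bounds[of a b xs] show ?case
    by (simp add: Let_def sum_list_replicate)
qed simp

lemma map_Suc_append_ones_inj:
  assumes "map Suc q @ replicate n 1 = map Suc q' @ replicate n' 1"
    and "\<forall>y\<in>set q. 0 < y" "\<forall>y\<in>set q'. 0 < y"
  shows "q = q'"
proof -
  \<comment> \<open>The parts of \<open>q\<close> are positive, so the shifted ones exceed 1 and the
    filter removes exactly the padding.\<close>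
  have "filter ((<) 1) (map Suc q @ replicate n 1) = map Suc q"
    "filter ((<) 1) (map Suc q' @ replicate n' 1) = map Suc q'"
    using assms(2,3) by (auto simp: filter_id_conv filter_empty_conv)
  with assms(1) have "map Suc q = map Suc q'" by metis
  then show ?thesis by (simp add: inj_map_eq_map)
qed

text \<open>The outermost hook can be read off: the first part gives the arm, the number of further
  parts the leg, and those of them above 1 the inner diagram.\<close>

lemma of_frobenius_inj:
  "\<lbrakk>sorted_wrt dominates xs; sorted_wrt dominates ys; of_frobenius xs = of_frobenius ys\<rbrakk> \<Longrightarrow> xs = ys"
proof (induction xs arbitrary: ys rule: of_frobenius.induct)
  case 1
  then show ?case by (cases ys rule: of_frobenius.cases) (auto simp: Let_def)
next
  case (2 a b xs)
  then obtain a' b' zs where ys: "ys = (a', b') # zs"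
    by (cases ys rule: of_frobenius.cases) (auto simp: Let_def)
  let ?q = "of_frobenius xs" and ?q' = "of_frobenius zs"
  have eq: "a = a'" "map Suc ?q @ replicate (b - length ?q) 1 = map Suc ?q' @ replicate (b' - length ?q') 1"
    using 2(4) by (simp_all add: ys Let_def)
  have "length ?q \<le> b" "length ?q' \<le> b'"
    using of_frobenius_bounds 2(2,3) ys by blast+
  with arg_cong[OF eq(2), of length] have "b = b'" by simp
  moreover have "?q = ?q'"
    using map_Suc_append_ones_inj[OF eq(2)] of_frobenius_pos by blast
  ultimately show ?case
    using 2 eq(1) by (auto simp: ys)
qed

text \<open>This removes the first column of a diagram: in weakly decreasing order the parts equal
  to 1 come last, and these rows vanish.\<close>

lemma map_Suc_append_ones_ex:
  assumes "sorted_wrt (\<ge>) r" "\<forall>y\<in>set r. 0 < (y::nat)"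
  shows "\<exists>q n. r = map Suc q @ replicate n 1 \<and> sorted_wrt (\<ge>) q \<and> (\<forall>y\<in>set q. 0 < y)"
  using assms
proof (induction r)
  case Nil
  then show ?case by simp
next
  case (Cons x r)
  then have "sorted_wrt (\<ge>) r" "\<forall>y\<in>set r. 0 < y"
    by simp_all
  then obtain q n where IH: "r = map Suc q @ replicate n 1" "sorted_wrt (\<ge>) q" "\<forall>y\<in>set q. 0 < y"
    using Cons.IH by blast
  show ?case
  proof (cases "x = 1")
    case True
    have "\<not> Suc y \<in> set r" if "0 < y" for y
      using Cons.prems(1) True that by auto
    then have "q = []"
      using IH(3) unfolding IH(1) by (cases q) auto
    then have "x # r = map Suc [] @ replicate (Suc n) 1"
      unfolding IH(1) True by simp
    then show ?thesis by (intro exI[of _ "[]"] exI[of _ "Suc n"]) simp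
  next
    case False
    with Cons.prems obtain z where z: "x = Suc z" "0 < z" by (cases x) auto
    have "y \<le> z" if "y \<in> set q" for y
      using Cons.prems(1) that by (auto simp: z IH(1))
    then show ?thesis
      using IH(2,3) z(2) by (intro exI[of _ "z # q"] exI[of _ n]) (auto simp: z(1) IH(1))
  qed
qed

lemma of_frobenius_surj:
  "\<lbrakk>sorted_wrt (\<ge>) p; \<forall>y\<in>set p. 0 < y\<rbrakk> \<Longrightarrow> \<exists>xs. sorted_wrt dominates xs \<and> of_frobenius xs = p"
proof (induction "length p" arbitrary: p rule: less_induct)
  case less
  show ?case
  proof (cases p)
    case Nil
    then show ?thesis by (intro exI[of _ "[]"]) simp
  next
    case (Cons x r)
    have "sorted_wrt (\<ge>) r" "\<forall>y\<in>set r. 0 < y"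
      using less.prems Cons by simp_all
    then obtain q n where q: "r = map Suc q @ replicate n 1" "sorted_wrt (\<ge>) q" "\<forall>y\<in>set q. 0 < y"
      using map_Suc_append_ones_ex by blast
    then have "length q < length p" by (simp add: Cons)
    then obtain ys where ys: "sorted_wrt dominates ys" "of_frobenius ys = q"
      using less.hyps q by blast
    \<comment> \<open>Arm and leg of the corner cell: \<open>x\<close> is the first row and
      \<open>r\<close> lists the rows below it.\<close>
    let ?x = "(x - 1, length r)"
    have "sorted_wrt dominates (?x # ys)"
    proof (cases ys rule: of_frobenius.cases)
      case (2 a b zs)
      have "length (of_frobenius zs) \<le> b" using of_frobenius_bounds ys(1) 2 by blast
      \<comment> \<open>The head \<open>(a, b)\<close> of \<open>ys\<close> makes
        \<open>Suc a\<close> a part of \<open>q\<close>, hence \<open>Suc (Suc a)\<close> a part of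
        \<open>r\<close>, which \<open>x\<close> bounds; and \<open>q\<close> has
        \<open>Suc b\<close> rows, at most as many as \<open>r\<close>.\<close>
      then have "Suc (Suc a) \<in> set r" "length q = Suc b"
        using ys(2) by (auto simp: 2 q(1) Let_def)
      moreover have "y \<le> x" if "y \<in> set r" for y
        using that less.prems(1) by (simp add: Cons)
      ultimately have "a < x - 1" "b < length r"
        by (fastforce, simp add: q(1))
      then have "dominates ?x (a, b)" by (simp add: dominates_def)
      then show ?thesis using ys(1) by (simp add: 2 sorted_wrt2[OF transp_dominates] del: sorted_wrt.simps(2))
    qed simp
    moreover have "of_frobenius (?x # ys) = p"
    proof -
      have "0 < x" using less.prems(2) by (simp add: Cons)
      then show ?thesis by (simp add: Cons Let_def ys(2)) (simp add: q(1))
    qed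
    ultimately show ?thesis by blast
  qed
qed

section \<open>Principal hooks and Durfee size in Frobenius coordinates\<close>

lemma young_diagram_of_frobenius:
  assumes "sorted_wrt dominates ((a, b) # xs)"
  shows "(0, j) \<in> young_diagram (of_frobenius ((a, b) # xs)) \<longleftrightarrow> j \<le> a"
    and "(i, 0) \<in> young_diagram (of_frobenius ((a, b) # xs)) \<longleftrightarrow> i \<le> b"
    and "(Suc i, Suc j) \<in> young_diagram (of_frobenius ((a, b) # xs)) \<longleftrightarrow>
      (i, j) \<in> young_diagram (of_frobenius xs)"
proof -
  have len: "length (of_frobenius xs) \<le> b"
    using of_frobenius_bounds[OF assms] by blast
  then have length: "length (of_frobenius ((a, b) # xs)) = Suc b"
    by (simp add: Let_def)
  show "(0, j) \<in> young_diagram (of_frobenius ((a, b) # xs)) \<longleftrightarrow> j \<le> a"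
    by (auto simp: young_diagram_def Let_def)
  \<comment> \<open>The first column reaches every row because all parts are positive.\<close>
  show "(i, 0) \<in> young_diagram (of_frobenius ((a, b) # xs)) \<longleftrightarrow> i \<le> b"
    using of_frobenius_pos[of "(a, b) # xs"] nth_mem[of i "of_frobenius ((a, b) # xs)"]
    unfolding young_diagram_def mem_Collect_eq case_prod_conv length
    by (auto simp: length simp del: of_frobenius.simps)
  show "(Suc i, Suc j) \<in> young_diagram (of_frobenius ((a, b) # xs)) \<longleftrightarrow>
      (i, j) \<in> young_diagram (of_frobenius xs)"
    using len by (auto simp: young_diagram_def Let_def nth_append)
qed

lemma hook_length_of_frobenius:
  "\<lbrakk>sorted_wrt dominates xs; i < length xs\<rbrakk> \<Longrightarrow>
     hook_length (of_frobenius xs) (i, i) = fst (xs ! i) + snd (xs ! i) + 1"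
proof (induction xs arbitrary: i)
  case (Cons x xs)
  obtain a b where x: "x = (a, b)" by (cases x)
  note YD = young_diagram_of_frobenius[OF Cons.prems(1)[unfolded x]]
  let ?p = "of_frobenius ((a, b) # xs)" and ?q = "of_frobenius xs"
  show ?case
  proof (cases i)
    case 0
    \<comment> \<open>The corner is counted with the arm, so the leg starts at row 1.\<close>
    have "{(k, l) \<in> young_diagram ?p. (k = 0 \<and> 0 \<le> l) \<or> (0 \<le> k \<and> l = 0)} =
        Pair 0 ` {..a} \<union> (\<lambda>k. (k, 0)) ` {1..b}"
      using YD(1,2) by (auto simp: image_iff simp del: of_frobenius.simps) 
    moreover have "card (Pair (0::nat) ` {..a} \<union> (\<lambda>k. (k, 0::nat)) ` {1..b}) = Suc a + b"
      by (subst card_Un_disjoint) (auto simp: card_image inj_on_def)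
    ultimately show ?thesis by (simp add: 0 x hook_length_def del: of_frobenius.simps)
  next
    case (Suc n)
    \<comment> \<open>This hook avoids the first row and column, so it is an inner hook moved by one
      along the diagonal.\<close>
    have "{(k, l) \<in> young_diagram ?p. (k = Suc n \<and> Suc n \<le> l) \<or> (Suc n \<le> k \<and> l = Suc n)} =
      map_prod Suc Suc ` {(k, l) \<in> young_diagram ?q. (k = n \<and> n \<le> l) \<or> (n \<le> k \<and> l = n)}"
      (is "?L = ?R")
    proof (intro equalityI subsetI)
      fix z assume z: "z \<in> ?L"
      then obtain k l where "z = (Suc k, Suc l)"
        by (cases z) (auto dest!: Suc_le_D)
      with z show "z \<in> ?R"
        using YD(3) by (auto simp: image_iff simp del: of_frobenius.simps)
    next
      fix z assume "z \<in> ?R"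
      then show "z \<in> ?L"
        using YD(3) by (auto simp del: of_frobenius.simps)
    qed
    then have "hook_length ?p (i, i) = hook_length ?q (n, n)"
      unfolding Suc hook_length_def case_prod_conv
      by (simp add: card_image prod.inj_map inj_on_subset[OF _ subset_UNIV] del: of_frobenius.simps)
    then show ?thesis using Cons by (simp add: x Suc del: of_frobenius.simps)
  qed
qed simp

lemma diagonal_of_frobenius:
  "sorted_wrt dominates xs \<Longrightarrow> (i, i) \<in> young_diagram (of_frobenius xs) \<longleftrightarrow> i < length xs"
proof (induction xs arbitrary: i)
  case Nil
  then show ?case by (simp add: young_diagram_def)
next
  case (Cons x xs)
  obtain a b where x: "x = (a, b)" by (cases x)
  show ?case
    using young_diagram_of_frobenius[OF Cons.prems[unfolded x]] Cons
    by (cases i) (auto simp: x simp del: of_frobenius.simps)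
qed

lemma young_diagram_downward:
  assumes "sorted_wrt (\<ge>) p" "(i, j) \<in> young_diagram p" "i' \<le> i" "j' \<le> j"
  shows "(i', j') \<in> young_diagram p"
proof -
  have "p ! i \<le> p ! i'"
    using assms by (cases "i' = i") (auto simp: young_diagram_def sorted_wrt_iff_nth_less)
  then show ?thesis using assms by (auto simp: young_diagram_def)
qed

lemma durfee_of_frobenius:
  assumes "sorted_wrt dominates xs"
  shows "durfee (of_frobenius xs) = length xs"
proof -
  have "{..<s} \<times> {..<s} \<subseteq> young_diagram (of_frobenius xs) \<longleftrightarrow> s \<le> length xs" for s
  proof (cases s)
    case (Suc t)
    \<comment> \<open>The diagram is closed downwards, so a square lies in it iff its far corner
      \<open>(t, t)\<close> does.\<close>
    have "{..<s} \<times> {..<s} \<subseteq> young_diagram (of_frobenius xs) \<longleftrightarrow> (t, t) \<in> young_diagram (of_frobenius xs)"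
      using young_diagram_downward[OF of_frobenius_sorted[OF assms], of t t] by (auto simp: Suc)
    then show ?thesis using diagonal_of_frobenius[OF assms, of t] by (auto simp: Suc)
  qed simp
  then have "{s. {..<s} \<times> {..<s} \<subseteq> young_diagram (of_frobenius xs)} = {..length xs}"
    by auto
  then show ?thesis by (auto simp: durfee_def intro: Max_eqI)
qed

section \<open>Partitions with even principal hooks as chains\<close>

definition opposite_parity :: "nat \<times> nat \<Rightarrow> bool" where
  "opposite_parity x \<longleftrightarrow> odd (fst x + snd x)"

definition half_hook :: "nat \<times> nat \<Rightarrow> nat" where
  "half_hook x = (fst x + snd x + 1) div 2"

text \<open>\<open>of_frobenius\<close> restricts to a bijection: the \<open>i\<close>-th principal
  hook has length arm plus leg plus 1, even iff the two have opposite parity, and then the hooks sum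
  to twice the half hooks.\<close>

lemma H_eq_card:
  "H d m = card {xs. length xs = d \<and> sorted_wrt dominates xs \<and> (\<forall>x\<in>set xs. opposite_parity x) \<and>
     sum_list (map half_hook xs) = m}"
    (is "_ = card ?A")
proof -
  have sum: "(\<Sum>(a, b)\<leftarrow>xs. a + b + 1) = 2 * sum_list (map half_hook xs)"
    if "\<forall>x\<in>set xs. opposite_parity x" for xs
    using that by (induction xs) (auto simp: opposite_parity_def half_hook_def)
  have even: "(\<forall>i. (i, i) \<in> young_diagram (of_frobenius xs) \<longrightarrow> even (hook_length (of_frobenius xs) (i, i)))
      \<longleftrightarrow> (\<forall>x\<in>set xs. opposite_parity x)" if "sorted_wrt dominates xs" for xs
    using hook_length_of_frobenius[OF that]
    by (auto simp: diagonal_of_frobenius[OF that] opposite_parity_def all_set_conv_all_nth)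
  have "{p. is_partition (2 * m) p \<and> durfee p = d \<and>
      (\<forall>i. (i, i) \<in> young_diagram p \<longrightarrow> even (hook_length p (i, i)))} = of_frobenius ` ?A" (is "?P = _")
  proof (intro equalityI subsetI)
    fix p assume p: "p \<in> ?P"
    then obtain xs where xs: "sorted_wrt dominates xs" "of_frobenius xs = p"
      using of_frobenius_surj[of p] by (auto simp: is_partition_def)
    with p even[OF xs(1)] have "\<forall>x\<in>set xs. opposite_parity x" by auto
    with p xs durfee_of_frobenius[OF xs(1)] of_frobenius_sum[OF xs(1)] sum show "p \<in> of_frobenius ` ?A"
      by (auto simp: is_partition_def)
  next
    fix p assume "p \<in> of_frobenius ` ?A"
    then show "p \<in> ?P"
      using even sum durfee_of_frobenius of_frobenius_sum of_frobenius_pos of_frobenius_sorted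
      by (auto simp: is_partition_def)
  qed
  moreover have "inj_on of_frobenius ?A"
    using of_frobenius_inj by (auto simp: inj_on_def)
  ultimately show ?thesis by (simp add: H_def card_image)
qed

section \<open>Frobenius arrays with shifted marks\<close>

definition dominates_marked :: "nat \<times> nat \<times> bool \<Rightarrow> nat \<times> nat \<times> bool \<Rightarrow> bool" where
  "dominates_marked = (\<lambda>(a, b, s) (a', b', s'). a' < a \<and> b' \<le> b \<and> (s \<longrightarrow> b' < b))"

definition column_weight :: "nat \<times> nat \<times> bool \<Rightarrow> nat" where
  "column_weight = (\<lambda>(a, b, s). a + b + 1)"

lemma transp_dominates_marked: "transp dominates_marked"
  by (auto simp: transp_def dominates_marked_def)

text \<open>Each mark moves one column to the left, where it forces the strict drop to the next
  bottom entry. The mark of the first entry, which is free, lands on the last column, where no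
  successor constrains it.\<close>

definition rotate_marks :: "nat list \<times> (nat \<times> bool) list \<Rightarrow> (nat \<times> nat \<times> bool) list" where
  "rotate_marks = (\<lambda>(a, b). zip a (zip (map fst b) (rotate1 (map snd b))))"

lemma rotate_marks_sorted_iff:
  assumes "length a = length b"
  shows "sorted_wrt dominates_marked (rotate_marks (a, b)) \<longleftrightarrow> sorted_wrt (>) a \<and> is_overpartition b"
proof -
  have tr: "transp (\<lambda>(a, s) (b, t). b \<le> a \<and> (t \<longrightarrow> b < (a::nat)))"
    by (auto simp: transp_def)
  have len: "length (rotate_marks (a, b)) = length b"
    using assms by (simp add: rotate_marks_def)
  \<comment> \<open>As \<open>Suc i < length b\<close>, the rotation reads the mark at
    \<open>Suc i\<close> without wrapping around; by transitivity, comparing neighbours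
    suffices.\<close>
  have step: "dominates_marked (rotate_marks (a, b) ! i) (rotate_marks (a, b) ! Suc i) \<longleftrightarrow>
      a ! Suc i < a ! i \<and> (\<lambda>(a, s) (b, t). b \<le> a \<and> (t \<longrightarrow> b < a)) (b ! i) (b ! Suc i)"
    if "Suc i < length b" for i
    using that assms
    by (simp add: rotate_marks_def dominates_marked_def nth_rotate1 split_beta)
  show ?thesis
    unfolding is_overpartition_def sorted_wrt_iff_nth_Suc_transp[OF transp_dominates_marked]
      sorted_wrt_iff_nth_Suc_transp[OF tr] sorted_wrt_iff_nth_Suc_transp[OF transp_on_greater]
      len assms
    by (simp add: step imp_conjR all_conj_distrib cong: imp_cong)
qed

lemma rotate_marks_weight:
  "length a = length b \<Longrightarrow> sum_list (map column_weight (rotate_marks (a, b))) = frobenius_weight (a, b)"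
proof -
  assume "length a = length b"
  \<comment> \<open>Marks carry no weight, so an arbitrary list \<open>c\<close> replaces the
    rotated one and the induction runs over three lists.\<close>
  moreover have "sum_list (map column_weight (zip a (zip b c))) = length a + sum_list a + sum_list b"
    if "length a = length b" "length b = length c" for a b and c :: "bool list"
    using that by (induction a b c rule: list_induct3) (auto simp: column_weight_def)
  ultimately show ?thesis
    by (simp add: rotate_marks_def frobenius_weight_def)
qed

lemma rotate_marks_inj: "inj_on rotate_marks {(a, b). length a = length b}"
proof (rule inj_onI, clarsimp)
  fix a a' and b b' :: "(nat \<times> bool) list"
  assume len: "length a = length b" "length a' = length b'"
    and eq: "rotate_marks (a, b) = rotate_marks (a', b')"
  have "map fst (rotate_marks (a, b)) = a" "map (fst \<circ> snd) (rotate_marks (a, b)) = map fst b"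
    "map (snd \<circ> snd) (rotate_marks (a, b)) = rotate1 (map snd b)" if "length a = length b"
    for a and b :: "(nat \<times> bool) list"
    using that by (simp_all add: rotate_marks_def flip: map_map)
  from this[OF len(1)] this[OF len(2)] eq
  have "a = a'" "map fst b = map fst b'" "rotate1 (map snd b) = rotate1 (map snd b')"
    by metis+
  then show "a = a' \<and> b = b'"
    using inj_rotate1 by (metis injD zip_map_fst_snd)
qed

lemma overpartitions_with_columns_eq_card:
  "overpartitions_with_columns d m =
     card {xs. length xs = d \<and> sorted_wrt dominates_marked xs \<and> sum_list (map column_weight xs) = m}"
    (is "_ = card ?A")
proof -
  let ?F = "{A. is_frobenius_array d A \<and> frobenius_weight A = m}"
  have "rotate_marks ` ?F = ?A"
  proof (intro equalityI subsetI)
    fix xs assume "xs \<in> rotate_marks ` ?F"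
    then obtain a b where A: "length a = d" "length b = d" "sorted_wrt (>) a" "is_overpartition b"
      "frobenius_weight (a, b) = m" and xs: "xs = rotate_marks (a, b)"
      by (auto simp: is_frobenius_array_def)
    then have len: "length a = length b" by simp
    show "xs \<in> ?A"
      using A rotate_marks_sorted_iff[OF len] rotate_marks_weight[OF len]
      by (simp add: xs) (simp add: rotate_marks_def)
  next
    fix xs assume xs: "xs \<in> ?A"
    \<comment> \<open>Rotating the marks back recovers the overlining of the bottom row.\<close>
    obtain c where c: "rotate1 c = map (snd \<circ> snd) xs"
      using surj_rotate1 by (metis surj_def)
    then have lc: "length c = length xs" by (metis length_map length_rotate1)
    define a b where "a = map fst xs" and "b = zip (map (fst \<circ> snd) xs) c"
    have len: "length a = length b" and d: "length a = length xs" by (simp_all add: a_def b_def lc)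
    have "xs = rotate_marks (a, b)"
      by (simp add: rotate_marks_def a_def b_def lc c zip_map_fst_snd flip: map_map)
    with xs show "xs \<in> rotate_marks ` ?F"
      using rotate_marks_sorted_iff[OF len] rotate_marks_weight[OF len] len d
      by (auto simp: is_frobenius_array_def intro!: image_eqI[of _ _ "(a, b)"])
  qed
  moreover have "inj_on rotate_marks ?F"
    by (rule inj_on_subset[OF rotate_marks_inj]) (auto simp: is_frobenius_array_def)
  ultimately show ?thesis
    unfolding overpartitions_with_columns_def using card_image[of rotate_marks ?F] by simp
qed

section \<open>The two instances\<close>

lemma hook_eq_twice_half_hook: "opposite_parity x \<Longrightarrow> fst x + snd x + 1 = 2 * half_hook x"
  unfolding opposite_parity_def half_hook_def by simp

lemma weighted_chains_hooks: "weighted_chains dominates opposite_parity half_hook"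
proof
  show "transp dominates" by (rule transp_dominates)
  show "half_hook y \<le> half_hook x" if "dominates x y" for x y
    using that by (auto simp: dominates_def half_hook_def intro: div_le_mono)
  \<comment> \<open>The equation arm plus leg equals \<open>2 * n - 1\<close> has
    \<open>2 * n\<close> solutions; for \<open>n = 0\<close> there is no pair, as half hooks are
    then at least 1.\<close>
  have level: "{x. opposite_parity x \<and> half_hook x = n} = (\<lambda>t. (t, 2 * n - 1 - t)) ` {..<2 * n}" for n
  proof (intro equalityI subsetI)
    fix x assume x: "x \<in> {x. opposite_parity x \<and> half_hook x = n}"
    then have "fst x + snd x = 2 * n - 1" "0 < n"
      using hook_eq_twice_half_hook[of x] by auto
    then show "x \<in> (\<lambda>t. (t, 2 * n - 1 - t)) ` {..<2 * n}"
      by (intro image_eqI[of _ _ "fst x"]) (auto simp: prod_eq_iff)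
  qed (auto simp: opposite_parity_def half_hook_def)
  show "finite {x. opposite_parity x \<and> half_hook x = n}" for n
    unfolding level by simp
  show "card {x. opposite_parity x \<and> half_hook x = n} = 2 * n" for n
    unfolding level by (simp add: card_image inj_on_def)
  show "card {x. opposite_parity x \<and> dominates x y \<and> half_hook x = half_hook y + j} = 2 * j - 1"
    if "opposite_parity y" for y j
  proof -
    \<comment> \<open>A gap \<open>j\<close> raises arm plus leg by \<open>2 * j\<close>, split into
      two positive increments \<open>t\<close> and \<open>2 * j - t\<close>.\<close>
    have "{x. opposite_parity x \<and> dominates x y \<and> half_hook x = half_hook y + j} =
        (\<lambda>t. (fst y + t, snd y + (2 * j - t))) ` {1..<2 * j}" (is "?L = ?R")
    proof (intro equalityI subsetI)
      fix x assume x: "x \<in> ?L"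
      then have "fst x + snd x = fst y + snd y + 2 * j" "fst y < fst x" "snd y < snd x"
        using hook_eq_twice_half_hook[of x] hook_eq_twice_half_hook[OF that]
        by (auto simp: dominates_def)
      then show "x \<in> ?R"
        by (intro image_eqI[of _ _ "fst x - fst y"]) (auto simp: prod_eq_iff)
    next
      fix x assume "x \<in> ?R"
      then obtain t where t: "x = (fst y + t, snd y + (2 * j - t))" "1 \<le> t" "t < 2 * j" by auto
      then have "fst x + snd x = fst y + snd y + 2 * j" by simp
      then show "x \<in> ?L"
        using that t by (auto simp: opposite_parity_def half_hook_def dominates_def)
    qed
    then show ?thesis by (simp add: card_image inj_on_def)
  qed
qed

lemma weighted_chains_columns: "weighted_chains dominates_marked (\<lambda>_. True) column_weight"
proof
  show "transp dominates_marked" by (rule transp_dominates_marked)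
  show "column_weight y \<le> column_weight x" if "dominates_marked x y" for x y
    using that by (auto simp: dominates_marked_def column_weight_def)
  \<comment> \<open>There are \<open>n\<close> ways to split \<open>n - 1\<close> into top and
    bottom entry, each with either mark.\<close>
  have level: "{x. True \<and> column_weight x = n} = (\<lambda>(t, s). (t, n - 1 - t, s)) ` ({..<n} \<times> UNIV)" for n
    by (force simp: column_weight_def image_iff)
  show "finite {x. True \<and> column_weight x = n}" for n
    unfolding level by simp
  show "card {x. True \<and> column_weight x = n} = 2 * n" for n
    unfolding level by (subst card_image) (auto simp: inj_on_def card_cartesian_product)
  show "card {x. True \<and> dominates_marked x y \<and> column_weight x = column_weight y + j} = 2 * j - 1" for y j
  proof -
    obtain a b s where y: "y = (a, b, s)" by (cases y)
    \<comment> \<open>The top entry grows by \<open>t \<ge> 1\<close> and the bottom one by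
      \<open>j - t\<close>. An unmarked \<open>x\<close> allows \<open>t = j\<close>; a mark demands
      a strict drop and excludes it.\<close>
    have "{x. True \<and> dominates_marked x y \<and> column_weight x = column_weight y + j} =
        (\<lambda>t. (a + t, b + (j - t), False)) ` {1..j} \<union> (\<lambda>t. (a + t, b + (j - t), True)) ` {1..<j}"
      (is "?L = ?R")
    proof (intro equalityI subsetI)
      fix x assume x: "x \<in> ?L"
      obtain a' b' s' where x': "x = (a', b', s')" by (cases x)
      from x have "a < a'" "b \<le> b'" "s' \<longrightarrow> b < b'" "a' + b' = a + b + j"
        by (auto simp: x' y dominates_marked_def column_weight_def)
      then show "x \<in> ?R"
        by (cases s') (auto simp: x' image_iff intro!: bexI[of _ "a' - a"])
    qed (auto simp: y dominates_marked_def column_weight_def)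
    moreover have "card ?R = j + (j - 1)"
      by (subst card_Un_disjoint) (auto simp: card_image inj_on_def)
    ultimately show ?thesis by simp
  qed
qed

interpretation hooks: weighted_chains dominates opposite_parity half_hook
  by (rule weighted_chains_hooks)

interpretation columns: weighted_chains dominates_marked "\<lambda>_. True" column_weight
  by (rule weighted_chains_columns)

section \<open>Comparison of the two chain counts\<close>

lemma H_eq_card_chains: "H d m = card {xs \<in> hooks.chains d. hooks.weight 0 xs = m}"
  by (simp add: H_eq_card hooks.chains_def hooks.weight_def conj_assoc)

lemma overpartitions_with_columns_eq_card_chains:
  "overpartitions_with_columns d m = card {xs \<in> columns.chains d. columns.weight 0 xs = m}"
  by (simp add: overpartitions_with_columns_eq_card columns.chains_def columns.weight_def conj_assoc)

theorem theorem5p3: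
  "(\<forall>d\<ge>1. Abs_fps (\<lambda>m. of_nat (H d m) :: rat) =
       2 * fps_X ^ ((d + 1) choose 2) * qpoch (- fps_X) fps_X (d - 1) / (qpoch fps_X fps_X d)\<^sup>2) \<and>
   Abs_fps (\<lambda>m. of_nat (H 0 m) :: rat) = 1 \<and>
   (\<forall>d\<ge>1. 2 * fps_X ^ ((d + 1) choose 2) * qpoch (- fps_X) fps_X (d - 1) / (qpoch fps_X fps_X d)\<^sup>2 =
       Abs_fps (\<lambda>m. of_nat (overpartitions_with_columns d m) :: rat)) \<and>
   (\<forall>m d. H d m = overpartitions_with_columns d m)"
proof -
  have hooks: "Abs_fps (\<lambda>m. of_nat (H d m) :: rat) =
      2 * fps_X ^ ((d + 1) choose 2) * qpoch (- fps_X) fps_X (d - 1) / (qpoch fps_X fps_X d)\<^sup>2"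
    if "1 \<le> d" for d
    using hooks.gf_closed_form[OF that] by (simp add: hooks.gf_def H_eq_card_chains)
  have columns: "Abs_fps (\<lambda>m. of_nat (overpartitions_with_columns d m) :: rat) =
      2 * fps_X ^ ((d + 1) choose 2) * qpoch (- fps_X) fps_X (d - 1) / (qpoch fps_X fps_X d)\<^sup>2"
    if "1 \<le> d" for d
    using columns.gf_closed_form[OF that]
    by (simp add: columns.gf_def overpartitions_with_columns_eq_card_chains)
  have H_0: "H 0 m = (if m = 0 then 1 else 0)" for m
    unfolding H_eq_card_chains by (rule hooks.card_chains_0)
  have "H d m = overpartitions_with_columns d m" for d m
  \<comment> \<open>The closed form starts at \<open>d = 1\<close>; for \<open>d = 0\<close> both
    sides count the empty chain.\<close>
  proof (cases "d = 0")
    case True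
    then show ?thesis
      by (simp add: H_0 overpartitions_with_columns_eq_card_chains columns.card_chains_0)
  next
    case False
    then have "Abs_fps (\<lambda>m. of_nat (H d m) :: rat) =
        Abs_fps (\<lambda>m. of_nat (overpartitions_with_columns d m))"
      using hooks columns by simp
    \<comment> \<open>Coefficients are compared, and \<open>of_nat\<close> into the rationals is
      injective.\<close>
    then show ?thesis by (simp add: fps_eq_iff)
  qed
  moreover have "Abs_fps (\<lambda>m. of_nat (H 0 m) :: rat) = 1"
    by (rule fps_ext) (simp add: H_0)
  ultimately show ?thesis using hooks columns by simp
qed

end
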